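(* Let $K$ be a field of characteristic $0$ and let $G(x,t),F(x,t)\in K[[x,t]]$. Suppose $G(x,0)=ax+(\text{terms of higher degree in }x)$ with $a\in K$, $a\neq 0$. Then $$\mathop{\mathrm{CT}}_x\ \frac{x}{G(x,t)}\,F(x,t)=\left.\frac{F(x,t)}{\frac{\partial}{\partial x}G(x,t)}\right|_{x=X},$$ where $X=X(t)$ is the unique element of $tK[[t]]$ such that $G(X,t)=0$, and where $1/G(x,t)$ is computed in the field $K((x))((t))$.
   Context: $K((x))((t))$ is the field of Laurent series in $t$ with coefficients in the field $K((x))$ of Laurent series in $x$. For $f=\sum_{n\ge n_0}a_n(x)t^n\in K((x))((t))$ with $a_n(x)\in K((x))$, $\mathrm{CT}_xf=\sum_{n\ge n_0}([x^0]a_n(x))\,t^n\in K((t))$. *)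

theory Defs
  imports "HOL-Computational_Algebra.Computational_Algebra"
begin

unbundle fps_syntax

text \<open>
  A power series in \<open>K[[x,t]]\<close> is represented as a series in the outer variable \<open>t\<close> whose
  coefficients are series in the inner variable \<open>x\<close>, so that \<open>F $ n $ i\<close> is the coefficient of
  \<open>x^i t^n\<close>. Likewise \<^typ>\<open>'a fls fls\<close> is \<open>K((x))((t))\<close>, with \<open>t\<close> outermost.
\<close>

definition fps2_to_fls2 :: "'a::zero fps fps \<Rightarrow> 'a fls fls" where
  "fps2_to_fls2 F = fps_to_fls (Abs_fps (\<lambda>n. fps_to_fls (F $ n)))"

lemma fps2_to_fls2_nth:
  "fps2_to_fls2 F $$ n $$ i = (if n < 0 \<or> i < 0 then 0 else F $ nat n $ nat i)"
  by (simp add: fps2_to_fls2_def)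

definition x_fls2 :: "'a::{zero,one} fls fls" where
  "x_fls2 = fls_const fls_X"

definition CT_x :: "'a::zero fls fls \<Rightarrow> 'a fls" where
  "CT_x f = Abs_fls (\<lambda>n. f $$ n $$ 0)"

lemma CT_x_nth [simp]: "CT_x f $$ n = f $$ n $$ 0"
proof -
  obtain N where "\<forall>n<N. f $$ n = 0"
    by (rule fls_nth_vanishes_belowE)
  then show ?thesis
    unfolding CT_x_def by (intro nth_Abs_fls_lower_bound[of N]) simp
qed

definition deriv_x :: "'a::semiring_1 fps fps \<Rightarrow> 'a fps fps" where
  "deriv_x F = Abs_fps (\<lambda>n. fps_deriv (F $ n))"

text \<open>
  The substitution \<open>F(X(t),t)\<close>, i.e.\ the sum of all \<open>F $ k (X(t)) t^k\<close>; as with \<^const>\<open>fps_compose\<close>,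
  it is meaningful only when \<open>X $ 0 = 0\<close>.
\<close>

definition subst_x :: "'a::semiring_1 fps fps \<Rightarrow> 'a fps \<Rightarrow> 'a fps" where
  "subst_x F X = Abs_fps (\<lambda>n. \<Sum>k\<le>n. (F $ k oo X) $ (n - k))"

lemma sums_subst_x:
  fixes F :: "'a::comm_ring_1 fps fps"
  shows "(\<lambda>k. (F $ k oo X) * fps_X ^ k) sums subst_x F X"
  unfolding sums_def
proof (rule tendsto_fpsI)
  fix n
  have "(\<Sum>k<N. (F $ k oo X) * fps_X ^ k) $ n = subst_x F X $ n" if "N > n" for N
  proof -
    have "(\<Sum>k<N. (F $ k oo X) * fps_X ^ k) $ n
        = (\<Sum>k<N. if n < k then 0 else (F $ k oo X) $ (n - k))"
      by (simp add: fps_sum_nth fps_X_power_mult_right_nth)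
    also have "\<dots> = (\<Sum>k\<le>n. (F $ k oo X) $ (n - k))"
      using that by (intro sum.mono_neutral_cong_right) auto
    finally show ?thesis
      by (simp add: subst_x_def)
  qed
  then show "\<forall>\<^sub>F N in sequentially. (\<Sum>k<N. (F $ k oo X) * fps_X ^ k) $ n = subst_x F X $ n"
    by (rule eventually_sequentiallyI[of "Suc n"]) simp
qed

end

theory Submission
  imports Defs
begin

text \<open>
  Weierstrass division by \<open>G\<close> writes \<open>x = X(t) + G Q\<close>.  Substituting any root of \<open>G\<close> for \<open>x\<close>
  shows that \<open>X\<close> is the only one, and differentiating shows that \<open>Q(X,t)\<close> is the inverse of
  \<open>\<partial>G/\<partial>x (X,t)\<close>.  Moreover \<open>x F / G = x / (x - X) \<cdot> F Q\<close>.  Dividing \<open>F Q\<close> in turn by \<open>x - X\<close>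
  leaves the remainder \<open>F(X,t) Q(X,t)\<close>, and since \<open>x / (x - X)\<close> is \<open>1\<close> plus terms with negative
  powers of \<open>x\<close>, this remainder is the constant term.
\<close>

section \<open>Substitution of a series in \<open>t\<close> for \<open>x\<close> as a ring
  homomorphism\<close>

definition fps2_of_t :: "'a::zero fps \<Rightarrow> 'a fps fps" where
  "fps2_of_t c = Abs_fps (\<lambda>n. fps_const (c $ n))"

lemma fps2_of_t_nth [simp]: "fps2_of_t c $ n = fps_const (c $ n)"
  by (simp add: fps2_of_t_def)

lemma subst_x_nth: "subst_x F X $ n = (\<Sum>k\<le>n. (F $ k oo X) $ (n - k))"
  by (simp add: subst_x_def)

lemma subst_x_add: "subst_x (F + G) X = subst_x F X + subst_x G X"
  by (simp add: fps_eq_iff subst_x_nth fps_compose_add_distrib sum.distrib)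

lemma subst_x_diff:
  fixes F G :: "'a::comm_ring_1 fps fps"
  shows "subst_x (F - G) X = subst_x F X - subst_x G X"
  by (simp add: fps_eq_iff subst_x_nth fps_compose_sub_distrib sum_subtractf)

lemma subst_x_of_t [simp]:
  fixes c :: "'a::comm_ring_1 fps"
  shows "subst_x (fps2_of_t c) X = c"
proof (rule fps_ext)
  fix n
  have "subst_x (fps2_of_t c) X $ n = (\<Sum>k\<le>n. if k = n then c $ n else 0)"
    unfolding subst_x_nth by (intro sum.cong) auto
  then show "subst_x (fps2_of_t c) X $ n = c $ n"
    by simp
qed

lemma subst_x_const:
  fixes f :: "'a::comm_ring_1 fps"
  shows "subst_x (fps_const f) X = f oo X"
proof (rule fps_ext)
  fix n
  have "subst_x (fps_const f) X $ n = (\<Sum>k\<le>n. if k = 0 then (f oo X) $ n else 0)"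
    unfolding subst_x_nth by (intro sum.cong) auto
  then show "subst_x (fps_const f) X $ n = (f oo X) $ n"
    by simp
qed

lemma subst_x_t_mult:
  fixes F :: "'a::comm_ring_1 fps fps"
  shows "subst_x (fps_X * F) X = fps_X * subst_x F X"
proof (rule fps_ext)
  fix n
  show "subst_x (fps_X * F) X $ n = (fps_X * subst_x F X) $ n"
  proof (cases n)
    case 0
    then show ?thesis by (simp add: subst_x_nth)
  next
    case (Suc m)
    then show ?thesis
      by (simp add: subst_x_nth sum.atMost_Suc_shift del: sum.atMost_Suc)
  qed
qed

lemma fps_X_mult_shift:
  fixes f :: "'a::comm_ring_1 fps"
  shows "fps_X * fps_shift (Suc 0) f = f - fps_const (f $ 0)"
  by (rule fps_ext) auto

text \<open>In the outer ring \<open>fps_X\<close> is \<open>t\<close>, while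
  \<open>fps_const f\<close> is a series in \<open>x\<close> alone. Splitting off
  \<open>F = F $ 0 + t F'\<close> leaves composition of series in one variable plus a multiple of
  \<open>t\<close>; the factor \<open>t\<close> lowers the coefficient index, so induction on that
  index, for all \<open>F\<close> at once, applies to \<open>F'\<close>.\<close>

lemma subst_x_const_mult:
  fixes f :: "'a::field fps"
  assumes "X $ 0 = 0"
  shows "subst_x (fps_const f * F) X = (f oo X) * subst_x F X"
proof -
  have "subst_x (fps_const f * F) X $ n = ((f oo X) * subst_x F X) $ n" for n
  proof (induction n arbitrary: F)
    case (0 F)
    show ?case by (simp add: subst_x_nth)
  next
    case (Suc n F)
    define F' where "F' = fps_shift 1 F"
    have F: "F = fps_const (F $ 0) + fps_X * F'"
      by (simp add: F'_def fps_X_mult_shift)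
    have "fps_const f * F = fps_const (f * F $ 0) + fps_X * (fps_const f * F')"
      by (subst F) (simp add: algebra_simps flip: fps_const_mult)
    then have "subst_x (fps_const f * F) X
        = (f oo X) * (F $ 0 oo X) + fps_X * subst_x (fps_const f * F') X"
      by (simp add: subst_x_add subst_x_const subst_x_t_mult fps_compose_mult_distrib[OF assms])
    moreover have "(f oo X) * subst_x F X
        = (f oo X) * (F $ 0 oo X) + fps_X * ((f oo X) * subst_x F' X)"
      by (subst F) (simp add: subst_x_add subst_x_const subst_x_t_mult distrib_left distrib_right
          mult.assoc mult.left_commute)
    ultimately show ?case
      using Suc.IH[of F'] by simp
  qed
  then show ?thesis by (rule fps_ext)
qed

text \<open>The same splitting of \<open>F\<close> only; the term \<open>F $ 0\<close> is covered by
  the case of a factor free of \<open>t\<close>.\<close>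

lemma subst_x_mult:
  fixes F G :: "'a::field fps fps"
  assumes "X $ 0 = 0"
  shows "subst_x (F * G) X = subst_x F X * subst_x G X"
proof -
  have "subst_x (F * G) X $ n = (subst_x F X * subst_x G X) $ n" for n
  proof (induction n arbitrary: F)
    case (0 F)
    show ?case by (simp add: subst_x_nth fps_compose_mult_distrib[OF assms])
  next
    case (Suc n F)
    define F' where "F' = fps_shift 1 F"
    have F: "F = fps_const (F $ 0) + fps_X * F'"
      by (simp add: F'_def fps_X_mult_shift)
    have "F * G = fps_const (F $ 0) * G + fps_X * (F' * G)"
      by (subst F) (simp add: algebra_simps)
    then have "subst_x (F * G) X
        = (F $ 0 oo X) * subst_x G X + fps_X * subst_x (F' * G) X"
      by (simp add: subst_x_add subst_x_t_mult subst_x_const_mult[OF assms])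
    moreover have "subst_x F X * subst_x G X
        = (F $ 0 oo X) * subst_x G X + fps_X * (subst_x F' X * subst_x G X)"
      by (subst F) (simp add: subst_x_add subst_x_const subst_x_t_mult distrib_left distrib_right
          mult.assoc mult.left_commute)
    ultimately show ?case
      using Suc.IH[of F'] by simp
  qed
  then show ?thesis by (rule fps_ext)
qed

lemma deriv_x_mult:
  fixes F G :: "'a::comm_ring_1 fps fps"
  shows "deriv_x (F * G) = deriv_x F * G + F * deriv_x G"
  by (rule fps_ext)
    (simp add: deriv_x_def fps_mult_nth fps_deriv_sum sum.distrib add.commute)

section \<open>Weierstrass division by a series of order one in \<open>x\<close>\<close>

text \<open>Comparing coefficients of \<open>t^n\<close> in \<open>F = c + G Q\<close> determines
  \<open>Q $ n * G $ 0\<close> from the earlier coefficients, up to a constant. Since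
  \<open>G $ 0\<close> is \<open>x\<close> times a unit, the shift drops that constant and divides
  by \<open>x\<close>, and the inverse divides by the unit.\<close>

fun weierstrass_quotient :: "'a::field fps fps \<Rightarrow> 'a fps fps \<Rightarrow> nat \<Rightarrow> 'a fps" where
  "weierstrass_quotient G F n =
    fps_shift 1 (F $ n - (\<Sum>k<n. weierstrass_quotient G F k * G $ (n - k)))
      * inverse (fps_shift 1 (G $ 0))"

declare weierstrass_quotient.simps [simp del]

lemma weierstrass_division:
  fixes F G :: "'a::field fps fps"
  assumes "G $ 0 $ 0 = 0" and "G $ 0 $ 1 \<noteq> 0"
  obtains c Q where "F = fps2_of_t c + G * Q"
proof
  define q where "q = weierstrass_quotient G F"
  define R where "R n = F $ n - (\<Sum>k<n. q k * G $ (n - k))" for n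
  define u where "u = fps_shift 1 (G $ 0)"
  have G0: "G $ 0 = fps_X * u"
    using assms(1) by (simp add: u_def fps_X_mult_shift)
  have u: "inverse u * u = 1"
    using assms(2) by (intro inverse_mult_eq_1) (simp add: u_def)
  have q: "q n * G $ 0 = fps_X * fps_shift 1 (R n)" for n
  proof -
    have "q n = fps_shift 1 (R n) * inverse u"
      unfolding q_def R_def u_def by (rule weierstrass_quotient.simps)
    then have "q n * G $ 0 = fps_X * fps_shift 1 (R n) * (inverse u * u)"
      by (simp add: G0 mult_ac)
    then show ?thesis by (simp add: u)
  qed
  show "F = fps2_of_t (Abs_fps (\<lambda>n. R n $ 0)) + G * Abs_fps q"
  proof (rule fps_ext)
    fix n
    have "(G * Abs_fps q) $ n = (\<Sum>k\<le>n. q k * G $ (n - k))"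
      by (simp add: mult.commute[of G] fps_mult_nth atLeast0AtMost)
    \<comment> \<open>The summand \<open>k = n\<close> equals \<open>R n\<close> without its
      constant term, and the remaining ones add up to \<open>F $ n - R n\<close>.\<close>
    also have "\<dots> = F $ n - fps_const (R n $ 0)"
      by (simp add: q fps_X_mult_shift flip: lessThan_Suc_atMost) (simp add: R_def)
    finally show "F $ n = (fps2_of_t (Abs_fps (\<lambda>n. R n $ 0)) + G * Abs_fps q) $ n"
      by simp
  qed
qed

section \<open>Computation in \<open>K((x))[[t]]\<close> and the expansion of
  \<open>x / (x - X)\<close>\<close>

text \<open>The intermediate ring \<open>K((x))[[t]]\<close> allows negative powers of
  \<open>x\<close> but keeps power series arguments in \<open>t\<close> available.\<close>

definition fps2_to_fls_fps :: "'a::zero fps fps \<Rightarrow> 'a fls fps" where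
  "fps2_to_fls_fps F = Abs_fps (\<lambda>n. fps_to_fls (F $ n))"

lemma fps2_to_fls_fps_nth [simp]: "fps2_to_fls_fps F $ n = fps_to_fls (F $ n)"
  by (simp add: fps2_to_fls_fps_def)

lemma fps2_to_fls2_conv: "fps2_to_fls2 F = fps_to_fls (fps2_to_fls_fps F)"
  by (simp add: fps2_to_fls2_def fps2_to_fls_fps_def)

lemma fps2_to_fls_fps_add:
  "fps2_to_fls_fps (F + G) = fps2_to_fls_fps F + fps2_to_fls_fps G"
  by (rule fps_ext) simp

lemma fps2_to_fls_fps_mult:
  fixes F G :: "'a::comm_ring_1 fps fps"
  shows "fps2_to_fls_fps (F * G) = fps2_to_fls_fps F * fps2_to_fls_fps G"
proof (rule fps_ext)
  fix n
  have "fps_to_fls (\<Sum>i\<in>A. f i) = (\<Sum>i\<in>A. fps_to_fls (f i))" for A and f :: "nat \<Rightarrow> 'a fps"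
    by (induction A rule: infinite_finite_induct) simp_all
  then show "fps2_to_fls_fps (F * G) $ n = (fps2_to_fls_fps F * fps2_to_fls_fps G) $ n"
    by (simp add: fps_mult_nth fls_times_fps_to_fls)
qed

lemma fps2_to_fls_fps_x:
  "fps2_to_fls_fps (fps_const fps_X :: 'a::{zero_neq_one,monoid_add} fps fps) = fps_const fls_X"
  by (rule fps_ext) simp

lemma x_fls2_conv:
  "x_fls2 = fps2_to_fls2 (fps_const fps_X :: 'a::{zero_neq_one,monoid_add} fps fps)"
  by (simp add: x_fls2_def fps2_to_fls2_conv fps2_to_fls_fps_x)

lemma CT_x_fps_to_fls: "CT_x (fps_to_fls f) = fps_to_fls (Abs_fps (\<lambda>n. f $ n $$ 0))"
  by (rule fls_eqI) simp

text \<open>With \<open>E = X / x\<close>, the series \<open>Y = 1 / (1 - E)\<close> is the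
  geometric series in \<open>X / x\<close>. It exists because \<open>E\<close> is divisible by
  \<open>t\<close>, and all its terms except 1 carry negative powers of \<open>x\<close>.\<close>

lemma geometric_x_inverse:
  fixes X :: "'a::field fps"
  assumes "X $ 0 = 0"
  obtains Y where "fps2_to_fls_fps (fps_const fps_X - fps2_of_t X) * Y
      = fps2_to_fls_fps (fps_const fps_X)"
    and "\<And>n. Y $ n $$ 0 = (if n = 0 then 1 else 0)"
proof
  define E :: "'a fls fps" where "E = Abs_fps (\<lambda>n. fls_const (X $ n) * fls_X_inv)"
  define Y where "Y = inverse (1 - E)"
  have "E $ 0 = 0"
    using assms by (simp add: E_def)
  then have inv: "(1 - E) * Y = 1"
    unfolding Y_def by (subst mult.commute, intro inverse_mult_eq_1) simp
  have "fps2_to_fls_fps (fps_const fps_X - fps2_of_t X) = fps_const fls_X * (1 - E)"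
  proof (rule fps_ext)
    fix n
    have "fls_X * (1 - E) $ n = fls_X * (1 $ n) - fls_const (X $ n) * (fls_X * inverse fls_X)"
      by (simp add: E_def fls_inverse_X right_diff_distrib mult.left_commute)
    then show "fps2_to_fls_fps (fps_const fps_X - fps2_of_t X) $ n
        = (fps_const fls_X * (1 - E)) $ n"
      by simp
  qed
  then show "fps2_to_fls_fps (fps_const fps_X - fps2_of_t X) * Y
      = fps2_to_fls_fps (fps_const fps_X)"
    by (simp add: mult.assoc inv fps2_to_fls_fps_x)
  have Y_eq: "Y = 1 + E * Y"
    using inv by (simp add: algebra_simps)
  have Y_nth: "Y $ n = (if n = 0 then 1 else 0)
      + (\<Sum>k=0..n. fls_const (X $ k) * (fls_X_inv * Y $ (n - k)))" for n
    by (subst Y_eq) (simp add: fps_mult_nth E_def mult.assoc)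
  \<comment> \<open>The induction needs all exponents \<open>i\<close> from 0 on: multiplication by
    \<open>X / x\<close> makes the coefficient at \<open>i\<close> depend on those at
    \<open>i + 1\<close> of earlier \<open>Y $ (n - k)\<close>. The term \<open>k = 0\<close>
    vanishes as \<open>X $ 0 = 0\<close>.\<close>
  have *: "Y $ n $$ i = (if n = 0 \<and> i = 0 then 1 else 0)" if "i \<ge> 0" for n i
    using that
  proof (induction n arbitrary: i rule: less_induct)
    case (less n)
    have "X $ k * Y $ (n - k) $$ (i + 1) = 0" if "k \<le> n" for k
      using less.IH[of "n - k" "i + 1"] less.prems assms that by (cases "k = 0") auto
    then have "(\<Sum>k=0..n. X $ k * Y $ (n - k) $$ (i + 1)) = 0"
      by (intro sum.neutral) auto
    then show ?case
      by (subst Y_nth) (simp add: fls_nth_sum fls_X_inv_times_conv_shift)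
  qed
  show "Y $ n $$ 0 = (if n = 0 then 1 else 0)" for n
    by (simp add: *)
qed

section \<open>The root of \<open>G\<close> and the constant term\<close>

theorem mainTheorem2:
  fixes F G :: "'a::field_char_0 fps fps" and a :: 'a
  assumes "G $ 0 $ 0 = 0"
    and "G $ 0 $ 1 = a"
    and "a \<noteq> 0"
  shows "(\<exists>!X. X $ 0 = 0 \<and> subst_x G X = 0) \<and>
    (\<forall>X. X $ 0 = 0 \<and> subst_x G X = 0 \<longrightarrow>
      CT_x (x_fls2 / fps2_to_fls2 G * fps2_to_fls2 F) =
        fps_to_fls (subst_x F X) / fps_to_fls (subst_x (deriv_x G) X))"
proof -
  let ?x = "fps_const fps_X :: 'a fps fps"
  obtain X Q where xXQ: "?x = fps2_of_t X + G * Q"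
    using weierstrass_division[of G ?x] assms by auto
  have "?x $ 0 $ 0 = X $ 0 + G $ 0 $ 0 * Q $ 0 $ 0"
    by (subst xXQ) simp
  then have X0: "X $ 0 = 0"
    using assms(1) by simp
  \<comment> \<open>Stated for every \<open>Y\<close> without constant term: a root \<open>Y\<close>
    gives uniqueness, and \<open>Y = X\<close> is the start of the proof that \<open>X\<close> is a
    root.\<close>
  have subst_eq: "Y = X + subst_x G Y * subst_x Q Y" if "Y $ 0 = 0" for Y
  proof -
    have "subst_x ?x Y = Y"
      by (simp add: subst_x_const that)
    then show ?thesis
      by (subst (asm) xXQ) (simp add: subst_x_add subst_x_mult[OF that])
  qed
  have unique: "Y = X" if "Y $ 0 = 0" "subst_x G Y = 0" for Y
    using subst_eq[OF that(1)] that(2) by simp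

  have linear: "?x - fps2_of_t X = G * Q"
    using xXQ by (simp add: algebra_simps)
  have deriv: "deriv_x G * Q + G * deriv_x Q = 1"
  proof -
    have "deriv_x (?x - fps2_of_t X) = 1"
      by (rule fps_ext) (simp add: deriv_x_def)
    then show ?thesis
      by (simp add: linear deriv_x_mult)
  qed
  have "subst_x G X * subst_x Q X = 0"
    using subst_eq[OF X0] by simp
  \<comment> \<open>In the domain \<open>K[[t]]\<close> it remains to exclude
    \<open>Q(X,t) = 0\<close>. Its constant term is \<open>Q $ 0 $ 0\<close>, and the coefficient of
    \<open>x t^0\<close> in \<open>x = X + G Q\<close> gives
    \<open>1 = a * Q $ 0 $ 0\<close>.\<close>
  moreover have "subst_x Q X \<noteq> 0"
  proof
    assume "subst_x Q X = 0"
    then have "subst_x Q X $ 0 = 0" by simp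
    then have "Q $ 0 $ 0 = 0" by (simp add: subst_x_nth)
    moreover have "?x $ 0 $ 1 = (fps2_of_t X + G * Q) $ 0 $ 1"
      by (simp only: flip: xXQ)
    ultimately show False
      using assms(1) by (simp add: fps_mult_nth)
  qed
  ultimately have root: "subst_x G X = 0" by simp

  have "subst_x 1 X = 1"
    using subst_x_const[of 1 X] by simp
  then have deriv_root: "subst_x (deriv_x G) X * subst_x Q X = 1"
    using arg_cong[OF deriv, of "\<lambda>H. subst_x H X"]
    by (simp add: subst_x_add subst_x_mult[OF X0] root)

  \<comment> \<open>The divisor \<open>x - X\<close> qualifies: at \<open>t = 0\<close> it is
    \<open>x\<close>. It vanishes under substitution of \<open>X\<close>, which identifies
    \<open>c\<close>.\<close>
  obtain c R where FQ: "F * Q = fps2_of_t c + (?x - fps2_of_t X) * R"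
    using weierstrass_division[of "?x - fps2_of_t X" "F * Q"] X0 by auto
  have "c = subst_x (F * Q) X"
    unfolding FQ
    by (simp add: subst_x_add subst_x_diff subst_x_mult[OF X0] subst_x_const X0)
  also have "\<dots> = subst_x F X * subst_x Q X"
    by (rule subst_x_mult[OF X0])
  finally have c: "fps_to_fls c = fps_to_fls (subst_x F X) / fps_to_fls (subst_x (deriv_x G) X)"
    using deriv_root by (auto simp: eq_divide_eq mult_ac simp flip: fls_times_fps_to_fls)

  obtain Y where Y: "fps2_to_fls_fps (?x - fps2_of_t X) * Y = fps2_to_fls_fps ?x"
    and Y_nth: "\<And>n. Y $ n $$ 0 = (if n = 0 then 1 else 0)"
    using geometric_x_inverse[OF X0] by blast
  have "x_fls2 / fps2_to_fls2 G * fps2_to_fls2 F = fps_to_fls (fps2_to_fls_fps (F * Q) * Y)"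
  proof -
    have "fps2_to_fls2 G $$ 0 $$ 1 \<noteq> 0"
      using assms(2,3) by (simp add: fps2_to_fls2_nth)
    then have "fps2_to_fls2 G \<noteq> 0" by auto
    \<comment> \<open>Here \<open>x = (x - X) Y = G Q Y\<close>.\<close>
    moreover have "x_fls2 * fps2_to_fls2 F
        = fps2_to_fls2 G * fps_to_fls (fps2_to_fls_fps (F * Q) * Y)"
      unfolding x_fls2_conv fps2_to_fls2_conv
      by (simp add: linear fps2_to_fls_fps_mult mult_ac flip: Y fls_times_fps_to_fls)
    ultimately show ?thesis by (simp add: field_simps)
  qed
  \<comment> \<open>As \<open>(x - X) Y = x\<close>, the multiple of \<open>x - X\<close> becomes
    \<open>x R\<close>, which has no constant term in \<open>x\<close>.\<close>
  also have "fps2_to_fls_fps (F * Q) * Y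
      = fps2_to_fls_fps (fps2_of_t c) * Y + fps2_to_fls_fps (?x * R)"
    unfolding FQ fps2_to_fls_fps_add fps2_to_fls_fps_mult
    by (simp add: distrib_left distrib_right mult_ac flip: Y)
  also have "CT_x (fps_to_fls \<dots>) = fps_to_fls c"
  proof -
    have "(fps2_to_fls_fps (fps2_of_t c) * Y + fps2_to_fls_fps (?x * R)) $ n $$ 0 = c $ n" for n
    proof -
      \<comment> \<open>The coefficients of \<open>c\<close> are free of \<open>x\<close>, so only
        the constant terms of \<open>Y $ (n - k)\<close> enter, and these vanish unless
        \<open>k = n\<close>.\<close>
      have "(fps2_to_fls_fps (fps2_of_t c) * Y) $ n $$ 0 = (\<Sum>k=0..n. if k = n then c $ n else 0)"
        unfolding fps_mult_nth fls_nth_sum by (intro sum.cong) (auto simp: Y_nth)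
      then show ?thesis by simp
    qed
    then show ?thesis by (simp only: CT_x_fps_to_fls fps_nth_inverse)
  qed
  finally have "CT_x (x_fls2 / fps2_to_fls2 G * fps2_to_fls2 F)
      = fps_to_fls (subst_x F X) / fps_to_fls (subst_x (deriv_x G) X)"
    by (simp only: c)
  with X0 root unique show ?thesis by blast
qed

end
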